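(* Let $q=p^n$ where $p$ is a prime, let $\theta$ be a primitive element of $GF(q)$, and let $k\geq 3$ and $r\geq 1$ be integers with $q-1=kr$. Let $B:=\langle\theta^r\rangle\cup\{0\}\subseteq GF(q)$. Then the orbit of $B$ under the action of $PGL(2,q)$ on the $(k+1)$-subsets of $X=GF(q)\cup\{\infty\}$ is (the block set of) a simple $3$-$(q+1,k+1,\lambda)$ design on $X$, where $$\lambda=\begin{cases}2 & \text{if } k=3,\\ (k+1)(k-1) & \text{if } k\geq 4 \text{ and } k+1 \text{ does not divide } q,\\ k-1 & \text{if } k\geq 4 \text{ and } k+1 \text{ divides } q.\end{cases}$$
   Context: $PGL(2,q)$ is the group of maps $x\mapsto \frac{ax+b}{cx+d}$ on $X=GF(q)\cup\{\infty\}$ with $a,b,c,d\in GF(q)$, $ad-bc\neq 0$, with the usual conventions for $\infty$. $\langle\theta^r\rangle$ is the multiplicative subgroup of $GF(q)^*$ generated by $\theta^r$ (of order $k$). A $3$-$(v,k',\lambda)$ design is a pair $(X,\mathcal{B})$ with $|X|=v$ and $\mathcal{B}$ a collection of $k'$-subsets (blocks) of $X$ such that every $3$-subset of $X$ lies in exactly $\lambda$ blocks; it is simple if $\mathcal{B}$ has no repeated blocks. *)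

theory Defs
  imports "HOL-Algebra.Group_Action" "HOL-Library.Cardinality" "HOL-Library.Multiset"
    "HOL-Computational_Algebra.Primes"
begin

text \<open>The cyclic subgroup \<open>\<langle>g\<rangle>\<close> of the multiplicative group of a field, for \<open>g \<noteq> 0\<close>.\<close>

definition mult_span :: "'a::field \<Rightarrow> 'a set" where
  "mult_span g = range (\<lambda>i::int. g powi i)"

definition primitive_element :: "'a::{field,finite} \<Rightarrow> bool" where
  "primitive_element \<theta> \<longleftrightarrow> \<theta> \<noteq> 0 \<and> mult_span \<theta> = UNIV - {0}"

text \<open>The projective line over the field \<open>'a\<close> is the type \<open>'a option\<close>, with \<open>None\<close> as the
  point at infinity.\<close>

fun moebius_map :: "'a::field \<Rightarrow> 'a \<Rightarrow> 'a \<Rightarrow> 'a \<Rightarrow> 'a option \<Rightarrow> 'a option" where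
  "moebius_map a b c d (Some x) =
     (if c * x + d = 0 then None else Some ((a * x + b) / (c * x + d)))"
| "moebius_map a b c d None = (if c = 0 then None else Some (a / c))"

definition PGL2 :: "('a::field option \<Rightarrow> 'a option) monoid" where
  "PGL2 = \<lparr>carrier = {moebius_map a b c d | a b c d. a * d - b * c \<noteq> 0},
           monoid.mult = (\<circ>), one = id\<rparr>"

definition subset_action :: "nat \<Rightarrow> ('b \<Rightarrow> 'b) \<Rightarrow> 'b set \<Rightarrow> 'b set" where
  "subset_action m g = (\<lambda>S \<in> {S. card S = m}. g ` S)"

text \<open>Blocks form a multiset, so that repeated blocks are possible in a design that is not
  simple.\<close>

definition three_design :: "'b set \<Rightarrow> 'b set multiset \<Rightarrow> nat \<Rightarrow> nat \<Rightarrow> nat \<Rightarrow> bool" where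
  "three_design X \<B> v k l \<longleftrightarrow>
     finite X \<and> card X = v \<and>
     (\<forall>b \<in># \<B>. b \<subseteq> X \<and> card b = k) \<and>
     (\<forall>T. T \<subseteq> X \<and> card T = 3 \<longrightarrow> size {# b \<in># \<B>. T \<subseteq> b #} = l)"

definition simple_three_design :: "'b set \<Rightarrow> 'b set multiset \<Rightarrow> nat \<Rightarrow> nat \<Rightarrow> nat \<Rightarrow> bool" where
  "simple_three_design X \<B> v k l \<longleftrightarrow>
     three_design X \<B> v k l \<and> (\<forall>b. count \<B> b \<le> 1)"

lemma moebius_map_comp:
  fixes a b c d a' b' c' d' :: "'a::field"
  assumes "a * d - b * c \<noteq> 0" "a' * d' - b' * c' \<noteq> 0"
  shows "moebius_map a b c d \<circ> moebius_map a' b' c' d' =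
    moebius_map (a * a' + b * c') (a * b' + b * d') (c * a' + d * c') (c * b' + d * d')"
proof
  have key: "(if c * u + d * w = 0 then None else Some ((a * u + b * w) / (c * u + d * w))) =
      (if w = 0 then moebius_map a b c d None else moebius_map a b c d (Some (u / w)))"
    if uw: "u \<noteq> 0 \<or> w \<noteq> 0" for u w
  proof (cases "w = 0")
    case True
    then show ?thesis using uw by auto
  next
    case False
    then have "c * (u / w) + d = (c * u + d * w) / w" "a * (u / w) + b = (a * u + b * w) / w"
      by (simp_all add: field_simps)
    then show ?thesis using False by auto
  qed
  fix z
  show "(moebius_map a b c d \<circ> moebius_map a' b' c' d') z =
    moebius_map (a * a' + b * c') (a * b' + b * d') (c * a' + d * c') (c * b' + d * d') z"
  proof (cases z)
    case None
    have "a' \<noteq> 0 \<or> c' \<noteq> 0" using assms(2) by auto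
    from key[OF this] None show ?thesis by auto
  next
    case (Some x)
    have "a' * x + b' \<noteq> 0 \<or> c' * x + d' \<noteq> 0"
    proof (rule ccontr)
      assume "\<not> ?thesis"
      then have e: "b' = - (a' * x)" "d' = - (c' * x)" by (simp_all add: eq_neg_iff_add_eq_0 add.commute)
      have "a' * d' - b' * c' = 0" unfolding e by (simp add: algebra_simps)
      with assms(2) show False by simp
    qed
    from key[OF this]
    have "(moebius_map a b c d \<circ> moebius_map a' b' c' d') z =
      (if c * (a' * x + b') + d * (c' * x + d') = 0 then None
       else Some ((a * (a' * x + b') + b * (c' * x + d')) / (c * (a' * x + b') + d * (c' * x + d'))))"
      unfolding Some by (auto simp del: moebius_map.simps(2))
    moreover have "c * (a' * x + b') + d * (c' * x + d') = (c * a' + d * c') * x + (c * b' + d * d')"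
      "a * (a' * x + b') + b * (c' * x + d') = (a * a' + b * c') * x + (a * b' + b * d')"
      by (simp_all add: algebra_simps)
    ultimately show ?thesis unfolding Some by simp
  qed
qed

lemma group_PGL2: "group PGL2"
proof (rule groupI)
  fix f g :: "'a option \<Rightarrow> 'a option"
  assume "f \<in> carrier PGL2" "g \<in> carrier PGL2"
  then obtain a b c d a' b' c' d' where
    *: "f = moebius_map a b c d" "a * d - b * c \<noteq> 0"
      "g = moebius_map a' b' c' d'" "a' * d' - b' * c' \<noteq> 0"
    by (auto simp: PGL2_def)
  have "(a * a' + b * c') * (c * b' + d * d') - (a * b' + b * d') * (c * a' + d * c')
      = (a * d - b * c) * (a' * d' - b' * c')" by (simp add: algebra_simps)
  with * have "(a * a' + b * c') * (c * b' + d * d') - (a * b' + b * d') * (c * a' + d * c') \<noteq> 0"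
    by simp
  with * show "f \<otimes>\<^bsub>PGL2\<^esub> g \<in> carrier PGL2"
    by (auto simp: PGL2_def moebius_map_comp simp del: right_minus_eq)
next
  have "id = moebius_map (1::'a) 0 0 1"
  proof
    fix z :: "'a option" show "id z = moebius_map 1 0 0 1 z" by (cases z) auto
  qed
  then show "\<one>\<^bsub>PGL2\<^esub> \<in> carrier (PGL2 :: ('a option \<Rightarrow> 'a option) monoid)"
    by (force simp: PGL2_def)
next
  fix f :: "'a option \<Rightarrow> 'a option"
  assume "f \<in> carrier PGL2"
  then obtain a b c d where *: "f = moebius_map a b c d" "a * d - b * c \<noteq> 0"
    by (auto simp: PGL2_def)
  have n: "d * a - (- b) * (- c) \<noteq> 0" using *(2) by (simp add: mult.commute)
  have "moebius_map d (- b) (- c) a \<circ> f = id"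
  proof
    fix z
    have "a * d - b * c = d * a - b * c" by simp
    then show "(moebius_map d (- b) (- c) a \<circ> f) z = id z"
      unfolding *(1) moebius_map_comp[OF n *(2)] using *(2)
      by (cases z) (auto simp: field_simps)
  qed
  moreover have "moebius_map d (- b) (- c) a \<in> carrier PGL2"
    unfolding PGL2_def partial_object.simps using n by blast
  ultimately show "\<exists>g \<in> carrier PGL2. g \<otimes>\<^bsub>PGL2\<^esub> f = \<one>\<^bsub>PGL2\<^esub>"
    by (intro bexI) (simp_all add: PGL2_def)
qed (auto simp: PGL2_def)

lemma PGL2_bij:
  fixes f :: "'a::field option \<Rightarrow> 'a option"
  assumes "f \<in> carrier PGL2"
  shows "bij f"
proof -
  interpret group "PGL2 :: ('a option \<Rightarrow> 'a option) monoid" by (rule group_PGL2)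
  show ?thesis
    using l_inv[OF assms] r_inv[OF assms] by (auto simp: PGL2_def intro: o_bij)
qed

lemma subset_action_in_Bij:
  assumes "bij f"
  shows "subset_action m f \<in> Bij {S. card S = m}"
proof -
  have c: "card (f ` S) = card S" "card (inv_into UNIV f ` S) = card S" for S
    using assms by (meson card_image inj_on_subset bij_is_inj bij_imp_bij_inv subset_UNIV)+
  have "bij_betw ((`) f) {S. card S = m} {S. card S = m}"
    by (rule bij_betw_byWitness[where f' = "(`) (inv_into UNIV f)"])
      (use assms c in \<open>auto simp: image_image bij_is_inj bij_is_surj surj_f_inv_f\<close>)
  then show ?thesis
    by (simp add: subset_action_def Bij_def)
qed

lemma group_action_PGL2:
  "group_action (PGL2 :: ('a::field option \<Rightarrow> 'a option) monoid) {S. card S = m} (subset_action m)"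
proof (unfold group_action_def group_hom_def group_hom_axioms_def, intro conjI)
  show "subset_action m \<in> hom (PGL2 :: ('a option \<Rightarrow> 'a option) monoid) (BijGroup {S. card S = m})"
  proof (rule homI)
    fix f g :: "'a option \<Rightarrow> 'a option"
    assume fg: "f \<in> carrier PGL2" "g \<in> carrier PGL2"
    note B = fg[THEN PGL2_bij, THEN subset_action_in_Bij]
    have "card (g ` S) = card S" for S
      using PGL2_bij[OF fg(2)] by (meson card_image inj_on_subset bij_is_inj subset_UNIV)
    then have "subset_action m (f \<circ> g) = compose {S. card S = m} (subset_action m f) (subset_action m g)"
      by (auto simp: subset_action_def compose_def image_comp fun_eq_iff)
    then show "subset_action m (f \<otimes>\<^bsub>PGL2\<^esub> g) =
        subset_action m f \<otimes>\<^bsub>BijGroup {S. card S = m}\<^esub> subset_action m g"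
      using B by (simp add: BijGroup_def PGL2_def)
  qed (simp add: BijGroup_def subset_action_in_Bij PGL2_bij)
qed (simp_all add: group_PGL2 group_BijGroup)

end

theory Submission
  imports Defs "HOL-Number_Theory.Residues" "HOL-Computational_Algebra.Polynomial"
begin

text \<open>
  Since PGL(2,q) is sharply 3-transitive, the orbit of \<open>B\<close> is a 3-design with
  \<open>\<lambda> |S| = (k + 1) k (k - 1)\<close>, where \<open>S\<close> is the setwise stabilizer of \<open>B\<close>. Write \<open>M\<close> for the
  group of \<open>k\<close>-th roots of unity, so that \<open>B = M \<union> {0}\<close>. The elements of \<open>S\<close> fixing \<open>0\<close> are
  exactly the \<open>k\<close> dilations by \<open>M\<close>, because the inverses of the elements of \<open>M\<close> sum to \<open>0\<close>; as
  these are transitive on \<open>M\<close>, \<open>|S|\<close> is \<open>k\<close> if \<open>S\<close> fixes \<open>0\<close> and \<open>k (k + 1)\<close> otherwise.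

  For \<open>k = 3\<close> the map \<open>(1 - x) / (1 + 2 x)\<close> lies in \<open>S\<close>. If \<open>k + 1\<close> divides \<open>q\<close>, then \<open>B\<close> is a
  subfield and \<open>S\<close> contains a translation. Conversely let \<open>k \<ge> 4\<close> and let \<open>g \<in> S\<close> move \<open>0\<close>.
  An element of \<open>S\<close> multiplies the binary form \<open>x\<^bsup>k+1\<^esup> - x y\<^sup>k\<close> by a scalar, hence preserves the
  zeros of its Hessian, among which infinity is the only multiple one. So \<open>g\<close> is affine, and comparing
  coefficients and summing over \<open>B\<close> shows that \<open>B\<close> is closed under addition; by Lagrange \<open>k + 1\<close>
  divides \<open>q\<close>.
\<close>

section \<open>Sharp 3-transitivity and block counting\<close>

lemma moebius_map_in_PGL2: "a * d - b * c \<noteq> 0 \<Longrightarrow> moebius_map a b c d \<in> carrier PGL2"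
  unfolding PGL2_def by auto

lemma PGL2_cases:
  assumes "g \<in> carrier PGL2"
  obtains a b c d where "g = moebius_map a b c d" "a * d - b * c \<noteq> 0"
  using assms unfolding PGL2_def by auto

lemma PGL2_comp: "f \<in> carrier PGL2 \<Longrightarrow> g \<in> carrier PGL2 \<Longrightarrow> f \<circ> g \<in> carrier PGL2"
  using monoid.m_closed[OF group.is_monoid[OF group_PGL2]] by (simp add: PGL2_def)

lemma PGL2_inv_into:
  fixes g :: "'a::field option \<Rightarrow> 'a option"
  assumes "g \<in> carrier PGL2"
  shows "inv_into UNIV g \<in> carrier PGL2"
proof -
  have "m_inv PGL2 g \<circ> g = id" "m_inv PGL2 g \<in> carrier PGL2"
    using group.l_inv[OF group_PGL2 assms] group.inv_closed[OF group_PGL2 assms]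
    by (auto simp: PGL2_def)
  moreover from this have "m_inv PGL2 g = inv_into UNIV g"
    by (metis PGL2_bij[OF assms] bij_is_surj surj_iff o_assoc id_o o_id)
  ultimately show ?thesis by simp
qed

lemma PGL2_image_eq_iff:
  fixes g :: "'a::field option \<Rightarrow> 'a option"
  assumes "g \<in> carrier PGL2"
  shows "g x = y \<longleftrightarrow> inv_into UNIV g y = x"
  using PGL2_bij[OF assms] by (metis bij_inv_eq_iff)

lemma PGL2_card_image:
  fixes g :: "'a::field option \<Rightarrow> 'a option"
  assumes "g \<in> carrier PGL2"
  shows "card (g ` A) = card A"
  using PGL2_bij[OF assms] by (meson bij_is_inj card_image inj_on_subset subset_UNIV)

text \<open>The witness is the cross-ratio \<open>(t - u) (v - w) / ((t - w) (v - u))\<close> in the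
  variable \<open>t\<close>; if one of the three points is infinity, the two factors containing it
  are dropped.\<close>

lemma PGL2_to_0_1_infinity:
  fixes x y z :: "'a::field option"
  assumes "x \<noteq> y" "x \<noteq> z" "y \<noteq> z"
  shows "\<exists>g\<in>carrier PGL2. g x = Some 0 \<and> g y = Some 1 \<and> g z = None"
proof -
  consider (x) v w where "x = None" "y = Some v" "z = Some w"
    | (y) u w where "x = Some u" "y = None" "z = Some w"
    | (z) u v where "x = Some u" "y = Some v" "z = None"
    | (fin) u v w where "x = Some u" "y = Some v" "z = Some w"
    using assms by (cases x; cases y; cases z) auto
  then show ?thesis
  proof cases
    case x
    with assms show ?thesis
      by (intro bexI[of _ "moebius_map 0 (v - w) 1 (- w)"] moebius_map_in_PGL2) auto
  next
    case y
    with assms show ?thesis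
      by (intro bexI[of _ "moebius_map 1 (- u) 1 (- w)"] moebius_map_in_PGL2) auto
  next
    case z
    with assms show ?thesis
      by (intro bexI[of _ "moebius_map 1 (- u) 0 (v - u)"] moebius_map_in_PGL2) auto
  next
    case fin
    have "(v - w) * (- w * (v - u)) - (- u * (v - w)) * (v - u) = (v - w) * (v - u) * (u - w)"
      by (simp add: algebra_simps)
    moreover have "(v - u) * t + - w * (v - u) = (v - u) * (t - w)"
      "(v - w) * t + - u * (v - w) = (v - w) * (t - u)" for t
      by (simp_all add: algebra_simps)
    ultimately show ?thesis using fin assms
      by (intro bexI[of _ "moebius_map (v - w) (- u * (v - w)) (v - u) (- w * (v - u))"]
          moebius_map_in_PGL2)
        (auto simp only: moebius_map.simps mult_eq_0_iff split: if_splits, auto)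
  qed
qed

lemma PGL2_fix_0_1_infinity:
  fixes g :: "'a::field option \<Rightarrow> 'a option"
  assumes "g \<in> carrier PGL2" "g (Some 0) = Some 0" "g (Some 1) = Some 1" "g None = None"
  shows "g = id"
proof -
  obtain a b c d where g: "g = moebius_map a b c d" "a * d - b * c \<noteq> 0"
    using assms(1) by (rule PGL2_cases)
  have "c = 0" using assms(4) g by (auto split: if_splits)
  moreover from this have "b = 0" using assms(2) g by (auto split: if_splits)
  ultimately have "a = d" "d \<noteq> 0" using assms(3) g by (auto split: if_splits)
  show ?thesis
  proof
    fix z show "g z = id z"
      using \<open>c = 0\<close> \<open>b = 0\<close> \<open>a = d\<close> \<open>d \<noteq> 0\<close> g by (cases z) auto
  qed
qed

text \<open>Both triples are compared with 0, 1, infinity: maps are composed through this triple,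
  and uniqueness holds because only the identity fixes it pointwise.\<close>

lemma PGL2_sharply_3_transitive:
  fixes x y z x' y' z' :: "'a::field option"
  assumes "x \<noteq> y" "x \<noteq> z" "y \<noteq> z" and "x' \<noteq> y'" "x' \<noteq> z'" "y' \<noteq> z'"
  shows "\<exists>!g. g \<in> carrier PGL2 \<and> g x = x' \<and> g y = y' \<and> g z = z'"
proof -
  obtain f where f: "f \<in> carrier PGL2" "f x = Some 0" "f y = Some 1" "f z = None"
    using PGL2_to_0_1_infinity[OF assms(1-3)] by blast
  obtain h where h: "h \<in> carrier PGL2" "h x' = Some 0" "h y' = Some 1" "h z' = None"
    using PGL2_to_0_1_infinity[OF assms(4-6)] by blast
  have hi: "inv_into UNIV h (Some 0) = x'" "inv_into UNIV h (Some 1) = y'" "inv_into UNIV h None = z'"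
    and fi: "inv_into UNIV f (Some 0) = x" "inv_into UNIV f (Some 1) = y" "inv_into UNIV f None = z"
    using f h PGL2_image_eq_iff by blast+
  show ?thesis
  proof (rule ex1I)
    show "inv_into UNIV h \<circ> f \<in> carrier PGL2 \<and> (inv_into UNIV h \<circ> f) x = x' \<and>
      (inv_into UNIV h \<circ> f) y = y' \<and> (inv_into UNIV h \<circ> f) z = z'"
      using f h hi by (simp add: PGL2_comp PGL2_inv_into)
  next
    fix g assume g: "g \<in> carrier PGL2 \<and> g x = x' \<and> g y = y' \<and> g z = z'"
    have id: "h \<circ> g \<circ> inv_into UNIV f = id"
      by (rule PGL2_fix_0_1_infinity) (use g f h fi in \<open>simp_all add: PGL2_comp PGL2_inv_into\<close>)
    show "g = inv_into UNIV h \<circ> f"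
    proof
      fix t
      have "h (g (inv_into UNIV f (f t))) = f t" using fun_cong[OF id, of "f t"] by simp
      then show "g t = (inv_into UNIV h \<circ> f) t"
        using PGL2_bij[OF f(1)] PGL2_image_eq_iff[OF h(1)] by (simp add: bij_is_inj)
    qed
  qed
qed

lemma card_distinct_triples:
  assumes "finite A"
  shows "card {(x, y, z). x \<in> A \<and> y \<in> A \<and> z \<in> A \<and> x \<noteq> y \<and> x \<noteq> z \<and> y \<noteq> z}
    = card A * (card A - 1) * (card A - 2)"
proof -
  have "{(x, y, z). x \<in> A \<and> y \<in> A \<and> z \<in> A \<and> x \<noteq> y \<and> x \<noteq> z \<and> y \<noteq> z}
      = (SIGMA x:A. SIGMA y:A - {x}. A - {x, y})" by auto
  moreover have "card (A - {x, y}) = card A - 2" if "x \<in> A" "y \<in> A - {x}" for x y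
    using that assms by (subst card_Diff_subset) auto
  ultimately show ?thesis using assms by (simp add: card_SigmaI card_Diff_singleton)
qed

text \<open>Such a map is determined by the preimages of the points of \<open>T\<close>, and every
  ordered triple of distinct points of \<open>B\<close> occurs. The count is the same for all
  \<open>T\<close>, which makes the orbit a design.\<close>

lemma card_PGL2_covering_triple:
  fixes B T :: "'a::{field,finite} option set"
  assumes "card T = 3"
  shows "card {g \<in> carrier PGL2. T \<subseteq> g ` B} = card B * (card B - 1) * (card B - 2)"
proof -
  obtain x y z where T: "T = {x, y, z}" "x \<noteq> y" "x \<noteq> z" "y \<noteq> z"
    using assms by (metis card_3_iff)
  let ?D = "{(x, y, z). x \<in> B \<and> y \<in> B \<and> z \<in> B \<and> x \<noteq> y \<and> x \<noteq> z \<and> y \<noteq> z}"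
  have ex1: "\<exists>!g. g \<in> carrier PGL2 \<and> g (fst w) = x \<and> g (fst (snd w)) = y \<and> g (snd (snd w)) = z"
    if "w \<in> ?D" for w
    using that T by (intro PGL2_sharply_3_transitive) auto
  have in_D: "(inv_into UNIV g x, inv_into UNIV g y, inv_into UNIV g z) \<in> ?D"
    if g: "g \<in> carrier PGL2" "T \<subseteq> g ` B" for g
  proof -
    have "inv_into UNIV g t \<in> B" if "t \<in> T" for t
      using that g PGL2_image_eq_iff[OF g(1)] by (metis imageE subsetD)
    moreover have "inj (inv_into UNIV g)" using PGL2_bij[OF g(1)] by (simp add: bij_imp_bij_inv bij_is_inj)
    ultimately show ?thesis using T by (auto simp: inj_eq)
  qed
  have "bij_betw (\<lambda>g. (inv_into UNIV g x, inv_into UNIV g y, inv_into UNIV g z))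
      {g \<in> carrier PGL2. T \<subseteq> g ` B} ?D"
  proof (rule bij_betw_imageI)
    show "inj_on (\<lambda>g. (inv_into UNIV g x, inv_into UNIV g y, inv_into UNIV g z))
      {g \<in> carrier PGL2. T \<subseteq> g ` B}"
    proof (rule inj_onI)
      fix g h
      assume g: "g \<in> {g \<in> carrier PGL2. T \<subseteq> g ` B}" and h: "h \<in> {g \<in> carrier PGL2. T \<subseteq> g ` B}"
        and eq: "(inv_into UNIV g x, inv_into UNIV g y, inv_into UNIV g z)
          = (inv_into UNIV h x, inv_into UNIV h y, inv_into UNIV h z)"
      from g h have G: "g \<in> carrier PGL2" "h \<in> carrier PGL2" by auto
      from g have "(inv_into UNIV g x, inv_into UNIV g y, inv_into UNIV g z) \<in> ?D"
        using in_D by blast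
      from ex1[OF this] eq G show "g = h"
        using PGL2_image_eq_iff[OF G(1)] PGL2_image_eq_iff[OF G(2)] by (metis fst_conv snd_conv)
    qed
    show "(\<lambda>g. (inv_into UNIV g x, inv_into UNIV g y, inv_into UNIV g z)) `
      {g \<in> carrier PGL2. T \<subseteq> g ` B} = ?D"
    proof (intro equalityI subsetI)
      fix w assume w: "w \<in> ?D"
      obtain u v t where wt: "w = (u, v, t)" by (cases w)
      from ex1[OF w] wt obtain g where g: "g \<in> carrier PGL2" "g u = x" "g v = y" "g t = z" by auto
      have "w = (inv_into UNIV g x, inv_into UNIV g y, inv_into UNIV g z)"
        using g PGL2_image_eq_iff[OF g(1)] wt by metis
      moreover have "T \<subseteq> g ` B" using g w wt T by auto
      ultimately show "w \<in> (\<lambda>g. (inv_into UNIV g x, inv_into UNIV g y, inv_into UNIV g z)) `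
        {g \<in> carrier PGL2. T \<subseteq> g ` B}" using g by blast
    qed (use in_D in blast)
  qed
  from bij_betw_same_card[OF this] show ?thesis by (subst (asm) card_distinct_triples) simp_all
qed

section \<open>Stabilizers and the blocks through a triple\<close>

definition setwise_stabilizer :: "'a::field option set \<Rightarrow> ('a option \<Rightarrow> 'a option) set" where
  "setwise_stabilizer B = {g \<in> carrier PGL2. g ` B = B}"

lemma card_PGL2_fibre:
  fixes B :: "'a::{field,finite} option set"
  assumes h: "h \<in> carrier PGL2"
  shows "card {g \<in> carrier PGL2. g ` B = h ` B} = card (setwise_stabilizer B)"
proof -
  have inv: "inv_into UNIV h \<circ> h = id" "h \<circ> inv_into UNIV h = id"
    using PGL2_bij[OF h] by (auto simp: bij_is_inj bij_is_surj surj_iff[symmetric])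
  have "bij_betw ((\<circ>) h) (setwise_stabilizer B) {g \<in> carrier PGL2. g ` B = h ` B}"
  proof (rule bij_betw_byWitness[where f' = "(\<circ>) (inv_into UNIV h)"])
    show "(\<circ>) h ` setwise_stabilizer B \<subseteq> {g \<in> carrier PGL2. g ` B = h ` B}"
    proof (rule image_subsetI)
      fix g assume "g \<in> setwise_stabilizer B"
      then show "h \<circ> g \<in> {g \<in> carrier PGL2. g ` B = h ` B}"
        using h unfolding setwise_stabilizer_def
        by (metis (mono_tags) PGL2_comp image_comp mem_Collect_eq)
    qed
    show "(\<circ>) (inv_into UNIV h) ` {g \<in> carrier PGL2. g ` B = h ` B} \<subseteq> setwise_stabilizer B"
    proof (rule image_subsetI)
      fix g assume "g \<in> {g \<in> carrier PGL2. g ` B = h ` B}"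
      moreover have "inv_into UNIV h ` h ` B = B" by (simp add: image_comp inv(1))
      ultimately show "inv_into UNIV h \<circ> g \<in> setwise_stabilizer B"
        using h unfolding setwise_stabilizer_def
        by (metis (mono_tags) PGL2_comp PGL2_inv_into image_comp mem_Collect_eq)
    qed
  qed (auto simp: o_assoc inv)
  then show ?thesis by (simp add: bij_betw_same_card)
qed

text \<open>Both sides count the maps whose image of \<open>B\<close> contains \<open>T\<close>;
  grouped by that image, each block accounts for one coset of the stabilizer.\<close>

lemma card_blocks_times_card_stabilizer:
  fixes B T :: "'a::{field,finite} option set"
  assumes "card T = 3"
  shows "card {b \<in> (\<lambda>g. g ` B) ` carrier PGL2. T \<subseteq> b} * card (setwise_stabilizer B)
    = card B * (card B - 1) * (card B - 2)"
proof -
  let ?L = "{b \<in> (\<lambda>g. g ` B) ` carrier PGL2. T \<subseteq> b}"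
  have "{g \<in> carrier PGL2. T \<subseteq> g ` B} = (\<Union>b\<in>?L. {g \<in> carrier PGL2. g ` B = b})" by auto
  then have "card {g \<in> carrier PGL2. T \<subseteq> g ` B} = (\<Sum>b\<in>?L. card {g \<in> carrier PGL2. g ` B = b})"
    by (simp only:) (subst card_UN_disjoint, auto)
  also have "\<dots> = (\<Sum>b\<in>?L. card (setwise_stabilizer B))"
    by (intro sum.cong) (auto simp: card_PGL2_fibre)
  finally show ?thesis by (simp add: card_PGL2_covering_triple[OF assms])
qed

section \<open>Finite fields and polynomials\<close>

lemma finite_field_power_card:
  fixes x :: "'a::{field,finite}"
  assumes "x \<noteq> 0"
  shows "x ^ (CARD('a) - 1) = 1"
proof -
  let ?U = "UNIV - {0 :: 'a}"
  have "bij_betw ((*) x) ?U ?U"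
    by (rule bij_betw_byWitness[where f' = "\<lambda>y. y / x"]) (use assms in auto)
  then have "prod id ?U = (\<Prod>y\<in>?U. x * y)"
    by (metis (no_types, lifting) id_apply prod.cong prod.reindex_bij_betw)
  also have "\<dots> = x ^ (CARD('a) - 1) * prod id ?U"
    by (simp add: prod.distrib card_Diff_singleton)
  finally show ?thesis by simp
qed

lemma card_roots_of_unity_le:
  assumes "k > 0"
  shows "card {x :: 'a::{field,finite}. x ^ k = 1} \<le> k"
proof -
  let ?p = "[:0, 1:] ^ k - 1 :: 'a poly"
  have "poly ?p 0 \<noteq> 0" using assms by (simp add: power_0_left)
  then have "?p \<noteq> 0" by force
  from card_poly_roots_bound[OF this] have "card {x :: 'a. x ^ k = 1} \<le> Polynomial.degree ?p"
    by simp
  also have "\<dots> \<le> k"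
    by (intro degree_diff_le order.trans[OF degree_power_le]) auto
  finally show ?thesis .
qed

text \<open>The first \<open>k\<close> powers of \<open>\<theta> ^ r\<close> are distinct, and all
  its powers are \<open>k\<close>-th roots of unity, of which there are at most
  \<open>k\<close>.\<close>

lemma mult_span_power_primitive:
  fixes \<theta> :: "'a::{field,finite}"
  assumes "primitive_element \<theta>" "CARD('a) - 1 = k * r" "k \<ge> 1" "r \<ge> 1"
  shows "mult_span (\<theta> ^ r) = {x. x ^ k = 1}" "card {x :: 'a. x ^ k = 1} = k"
proof -
  define N where "N = CARD('a) - 1"
  have N: "N = k * r" "N > 0" using assms by (auto simp: N_def)
  have \<theta>: "\<theta> \<noteq> 0" "mult_span \<theta> = UNIV - {0}" using assms by (auto simp: primitive_element_def)
  have \<theta>N: "\<theta> ^ N = 1" unfolding N_def by (rule finite_field_power_card) fact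
  \<comment> \<open>Exponents reduce modulo \<open>N\<close>, so the powers with exponent below
    \<open>N\<close> exhaust the \<open>N\<close> nonzero elements and hence are distinct.\<close>
  have "UNIV - {0} \<subseteq> (\<lambda>i. \<theta> ^ i) ` {..<N}"
  proof
    fix x assume "x \<in> UNIV - {0 :: 'a}"
    then have "x \<in> mult_span \<theta>" using \<theta>(2) by simp
    then obtain i where i: "x = \<theta> powi i" by (auto simp: mult_span_def)
    have "i = int N * (i div int N) + i mod int N" by simp
    then have "x = (\<theta> powi int N) powi (i div int N) * \<theta> powi (i mod int N)"
      using i \<theta>(1) by (metis power_int_add power_int_mult)
    also have "\<dots> = \<theta> ^ nat (i mod int N)"
      using \<theta>N N(2) by (simp add: power_int_def)
    finally show "x \<in> (\<lambda>i. \<theta> ^ i) ` {..<N}" using N(2)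
      by (metis imageI lessThan_iff nat_less_iff pos_mod_bound pos_mod_sign of_nat_0_less_iff)
  qed
  then have "(\<lambda>i. \<theta> ^ i) ` {..<N} = UNIV - {0}" using \<theta>(1) by auto
  then have "inj_on (\<lambda>i. \<theta> ^ i) {..<N}"
    by (intro eq_card_imp_inj_on) (simp_all add: N_def card_Diff_singleton)
  then have inj: "i = j" if "\<theta> ^ i = \<theta> ^ j" "i < N" "j < N" for i j
    using that by (auto simp: inj_on_def)
  have "inj_on (\<lambda>i. (\<theta> ^ r) ^ i) {..<k}"
  proof (rule inj_onI)
    fix i j assume "i \<in> {..<k}" "j \<in> {..<k}" and eq: "(\<theta> ^ r) ^ i = (\<theta> ^ r) ^ j"
    then have "r * i < N" "r * j < N" using assms(4) N(1) by (simp_all add: mult.commute[of k])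
    with eq have "r * i = r * j" by (intro inj) (simp_all add: power_mult)
    then show "i = j" using assms(4) by simp
  qed
  then have "k = card ((\<lambda>i. (\<theta> ^ r) ^ i) ` {..<k})" by (simp add: card_image)
  also have "\<dots> \<le> card (mult_span (\<theta> ^ r))"
    by (intro card_mono) (auto simp: mult_span_def simp flip: power_int_of_nat)
  finally have le: "k \<le> card (mult_span (\<theta> ^ r))" .
  have sub: "mult_span (\<theta> ^ r) \<subseteq> {x. x ^ k = 1}"
  proof
    fix x assume "x \<in> mult_span (\<theta> ^ r)"
    then obtain i where "x = (\<theta> ^ r) powi i" by (auto simp: mult_span_def)
    then have "x ^ k = ((\<theta> ^ r) ^ k) powi i"
      by (metis mult.commute power_int_mult power_int_of_nat)
    also have "(\<theta> ^ r) ^ k = 1" using \<theta>N N(1) by (simp add: power_mult[symmetric] mult.commute)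
    finally show "x \<in> {x. x ^ k = 1}" by simp
  qed
  have "card {x :: 'a. x ^ k = 1} \<le> k" using assms by (intro card_roots_of_unity_le) simp
  with le show "mult_span (\<theta> ^ r) = {x. x ^ k = 1}" "card {x :: 'a. x ^ k = 1} = k"
    using card_mono[OF _ sub] card_subset_eq[OF _ sub] by simp_all
qed

text \<open>Translation by \<open>x \<in> H\<close> is injective on the finite set \<open>H\<close>,
  hence onto, and the preimage of 0 is \<open>- x\<close>. So \<open>H\<close> is a subgroup and
  Lagrange applies.\<close>

lemma card_add_closed_dvd_card_UNIV:
  fixes H :: "'a::{ab_group_add,finite} set"
  assumes "0 \<in> H" and add: "\<And>x y. x \<in> H \<Longrightarrow> y \<in> H \<Longrightarrow> x + y \<in> H"
  shows "card H dvd CARD('a)"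
proof -
  define G where "G = \<lparr>carrier = (UNIV :: 'a set), monoid.mult = (+), one = (0 :: 'a)\<rparr>"
  have "group G"
  proof (rule groupI)
    fix x show "\<exists>y\<in>carrier G. y \<otimes>\<^bsub>G\<^esub> x = \<one>\<^bsub>G\<^esub>"
      by (intro bexI[of _ "- x"]) (auto simp: G_def)
  qed (auto simp: G_def add_ac)
  then interpret group G .
  have "\<exists>y\<in>H. y + x = 0" if "x \<in> H" for x
  proof -
    have "(\<lambda>y. y + x) ` H = H"
      using add that by (intro endo_inj_surj) (auto simp: inj_on_def)
    with assms(1) show ?thesis by (metis imageE)
  qed
  then have neg: "- x \<in> H" if "x \<in> H" for x
    using that by (metis eq_neg_iff_add_eq_0)
  have "subgroup H G"
  proof (rule subgroupI)
    fix x assume x: "x \<in> H"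
    have "inv\<^bsub>G\<^esub> x = - x" by (rule inv_equality) (auto simp: G_def)
    with neg x show "inv\<^bsub>G\<^esub> x \<in> H" by simp
  qed (use assms in \<open>auto simp: G_def\<close>)
  from lagrange[OF this] have "card (rcosets\<^bsub>G\<^esub> H) * card H = CARD('a)"
    by (simp add: Coset.order_def) (simp add: G_def)
  then show ?thesis by (metis dvd_triv_right)
qed

text \<open>The product rule leaves \<open>v ^ n\<close> in both summands. Iterated, this turns a
  zero of high order into the vanishing of successive derivatives.\<close>

lemma dvd_pderiv_of_power_Suc_dvd:
  fixes v p :: "'a::idom poly"
  assumes "v ^ Suc n dvd p"
  shows "v ^ n dvd pderiv p"
proof -
  obtain w where "p = v ^ Suc n * w" using assms by (auto simp: dvd_def)
  then have "pderiv p = v ^ n * (v * pderiv w + w * smult (of_nat (Suc n)) (pderiv v))"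
    by (simp only: pderiv_mult pderiv_power_Suc) (simp add: algebra_simps)
  then show ?thesis by simp
qed

section \<open>The stabilizer of the block\<close>

text \<open>The primitive element enters the analysis of the stabilizer only through these facts on
  the \<open>k\<close>-th roots of unity and the characteristic.\<close>

locale unity_block =
  fixes k :: nat and M :: "'a::{field,finite} set"
  assumes k_ge: "k \<ge> 3" and M_eq: "M = {x. x ^ k = 1}" and card_M: "card M = k"
    and k_nonzero: "of_nat k \<noteq> (0 :: 'a)"
begin

definition block :: "'a option set" where "block = Some ` insert 0 M"

abbreviation stab :: "('a option \<Rightarrow> 'a option) set" where "stab \<equiv> setwise_stabilizer block"

lemma zero_notin_M: "0 \<notin> M" using k_ge by (auto simp: M_eq power_0_left)

lemma one_in_M: "1 \<in> M" by (simp add: M_eq)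

lemma mult_in_M: "x \<in> M \<Longrightarrow> y \<in> M \<Longrightarrow> x * y \<in> M" by (simp add: M_eq power_mult_distrib)

lemma divide_in_M: "x \<in> M \<Longrightarrow> y \<in> M \<Longrightarrow> x / y \<in> M" by (simp add: M_eq power_divide)

text \<open>Membership becomes one polynomial equation, the form used for the Frobenius argument and
  for comparing polynomials.\<close>

lemma in_insert_0_M_iff: "x \<in> insert 0 M \<longleftrightarrow> x ^ (k + 1) = x"
  by (auto simp: M_eq)

lemma card_insert_0_M: "card (insert 0 M) = k + 1"
  using zero_notin_M card_M by simp

lemma card_block: "card block = k + 1"
  unfolding block_def by (subst card_image) (use card_insert_0_M in auto)

lemma Some_in_block_iff [simp]: "Some x \<in> block \<longleftrightarrow> x \<in> insert 0 M"
  unfolding block_def by blast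

lemma None_notin_block [simp]: "None \<notin> block"
  unfolding block_def by blast

lemma stabI:
  assumes "g \<in> carrier PGL2" "\<And>x. x \<in> insert 0 M \<Longrightarrow> g (Some x) \<in> block"
  shows "g \<in> stab"
proof -
  have "g ` block \<subseteq> block" unfolding block_def using assms(2) block_def by auto
  then have "g ` block = block"
    by (intro card_subset_eq) (use assms(1) PGL2_card_image in auto)
  with assms(1) show ?thesis by (simp add: setwise_stabilizer_def)
qed

lemma stab_comp: "g \<in> stab \<Longrightarrow> h \<in> stab \<Longrightarrow> g \<circ> h \<in> stab"
  unfolding setwise_stabilizer_def by (metis (mono_tags) PGL2_comp image_comp mem_Collect_eq)

lemma stab_inv:
  assumes "g \<in> stab"
  shows "inv_into UNIV g \<in> stab"
proof -
  have g: "g \<in> carrier PGL2" "g ` block = block" using assms by (auto simp: setwise_stabilizer_def)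
  have "inv_into UNIV g ` g ` block = block"
    using PGL2_bij[OF g(1)] by (simp add: image_comp bij_is_inj)
  with g PGL2_inv_into show ?thesis by (auto simp: setwise_stabilizer_def)
qed

lemma stab_in_block: "g \<in> stab \<Longrightarrow> x \<in> block \<Longrightarrow> g x \<in> block"
  by (auto simp: setwise_stabilizer_def)

lemma stab_inj: "g \<in> stab \<Longrightarrow> g x = g y \<Longrightarrow> x = y"
  using PGL2_bij[of g] by (simp add: setwise_stabilizer_def bij_def inj_eq)

section \<open>The order of the stabilizer\<close>

lemma dilation_in_stab:
  assumes "a \<in> M"
  shows "moebius_map a 0 0 1 \<in> stab"
  by (rule stabI) (use assms zero_notin_M in \<open>auto intro!: moebius_map_in_PGL2 simp: mult_in_M\<close>)

text \<open>Multiplication by some \<open>z \<noteq> 1\<close> in \<open>M\<close> permutes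
  \<open>M\<close>, so it fixes the sum.\<close>

lemma sum_M: "\<Sum>M = 0"
proof -
  have "\<not> M \<subseteq> {1}" using card_M k_ge card_mono[of "{1}" M] by auto
  then obtain z where z: "z \<in> M" "z \<noteq> 1" by auto
  have "(*) z ` M = M"
    using z zero_notin_M by (intro endo_inj_surj) (auto simp: inj_on_def mult_in_M)
  then have "bij_betw ((*) z) M M" using z zero_notin_M by (auto simp: bij_betw_def inj_on_def)
  then have "(\<Sum>x\<in>M. z * x) = \<Sum>M" by (rule sum.reindex_bij_betw)
  then have "z * \<Sum>M = \<Sum>M" by (simp add: sum_distrib_left)
  with z show ?thesis by simp
qed

lemma sum_inverse_M: "(\<Sum>x\<in>M. inverse x) = 0"
proof -
  have "bij_betw inverse M M"
    by (rule bij_betw_byWitness[where f' = inverse]) (auto simp: M_eq power_inverse)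
  from sum.reindex_bij_betw[OF this, of "\<lambda>x. x"] show ?thesis using sum_M by simp
qed

text \<open>The reciprocal of \<open>a x / (c x + d)\<close> is \<open>c / a + (d / a) / x\<close>.
  As \<open>g\<close> permutes \<open>M\<close>, summing reciprocals over \<open>M\<close> gives
  \<open>0 = k c / a\<close>, hence \<open>c = 0\<close>.\<close>

lemma stab_fixing_0:
  assumes g: "g \<in> stab" "g (Some 0) = Some 0"
  obtains a where "a \<in> M" "g = moebius_map a 0 0 1"
proof -
  obtain a b c d where gm: "g = moebius_map a b c d" "a * d - b * c \<noteq> 0"
    using g(1) by (auto simp: setwise_stabilizer_def elim: PGL2_cases)
  have bd: "b = 0" "d \<noteq> 0" using g(2) gm by (auto split: if_splits)
  with gm have a: "a \<noteq> 0" by auto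
  define \<phi> where "\<phi> x = a * x / (c * x + d)" for x
  have \<phi>: "c * x + d \<noteq> 0" "g (Some x) = Some (\<phi> x)" "\<phi> x \<in> M" if x: "x \<in> M" for x
  proof -
    have "g (Some x) \<in> block" using stab_in_block[OF g(1), of "Some x"] x by simp
    then show cx: "c * x + d \<noteq> 0" using gm by (auto split: if_splits)
    then show gx: "g (Some x) = Some (\<phi> x)" using gm bd by (simp add: \<phi>_def)
    have "\<phi> x \<noteq> 0" using cx a x zero_notin_M by (auto simp: \<phi>_def)
    with \<open>g (Some x) \<in> block\<close> gx show "\<phi> x \<in> M" by simp
  qed
  have inj: "inj_on \<phi> M" using \<phi>(2) stab_inj[OF g(1)] by (metis inj_onI option.inject)
  have "\<phi> ` M = M" by (intro endo_inj_surj inj image_subsetI \<phi>(3)) auto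
  with inj have "bij_betw \<phi> M M" by (simp add: bij_betw_def)
  from sum.reindex_bij_betw[OF this, of inverse]
  have "0 = (\<Sum>x\<in>M. inverse (\<phi> x))" using sum_inverse_M by simp
  also have "\<dots> = (\<Sum>x\<in>M. c / a + d / a * inverse x)"
  proof (rule sum.cong)
    fix x assume x: "x \<in> M"
    then have "x \<noteq> 0" using zero_notin_M by auto
    then show "inverse (\<phi> x) = c / a + d / a * inverse x"
      using \<phi>(1)[OF x] a by (simp add: \<phi>_def field_simps)
  qed simp
  also have "\<dots> = of_nat k * (c / a)"
    unfolding sum.distrib sum_distrib_left[symmetric] sum_inverse_M by (simp add: card_M)
  finally have c: "c = 0" using k_nonzero a by simp
  show ?thesis
  proof (rule that)
    show "a / d \<in> M" using \<phi>(3)[OF one_in_M] c by (simp add: \<phi>_def)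
    show "g = moebius_map (a / d) 0 0 1"
    proof
      fix z show "g z = moebius_map (a / d) 0 0 1 z" using gm bd c by (cases z) auto
    qed
  qed
qed

lemma stab_fixing_0_eq: "{g \<in> stab. g (Some 0) = Some 0} = (\<lambda>a. moebius_map a 0 0 1) ` M"
proof (intro equalityI subsetI)
  fix g assume "g \<in> {g \<in> stab. g (Some 0) = Some 0}"
  then obtain a where "a \<in> M" "g = moebius_map a 0 0 1" using stab_fixing_0 by blast
  then show "g \<in> (\<lambda>a. moebius_map a 0 0 1) ` M" by blast
qed (use dilation_in_stab in auto)

lemma card_stab_fixing_0: "card {g \<in> stab. g (Some 0) = Some 0} = k"
proof -
  have "a = b" if "moebius_map a 0 0 1 = moebius_map b 0 0 1" for a b :: 'a
    using fun_cong[OF that, of "Some 1"] by simp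
  then have "inj_on (\<lambda>a. moebius_map a 0 0 1) M" by (auto simp: inj_on_def)
  then show ?thesis unfolding stab_fixing_0_eq by (simp add: card_image card_M)
qed

text \<open>Orbit-stabilizer: \<open>g\<close> carries 0 into \<open>M\<close>, where the dilations
  are transitive, so the orbit of 0 is the whole block.\<close>

lemma card_stab_if_moves_0:
  assumes "g \<in> stab" "g (Some 0) \<noteq> Some 0"
  shows "card stab = (k + 1) * k"
proof -
  have fibre: "card {h \<in> stab. h (Some 0) = y} = k" if y: "y \<in> block" for y
  proof -
    have "\<exists>h\<in>stab. h (Some 0) = y"
    proof -
      obtain e where e: "g (Some 0) = Some e" "e \<in> M"
        using stab_in_block[OF assms(1), of "Some 0"] assms(2) by (cases "g (Some 0)") auto
      obtain m where m: "y = Some m" "m \<in> insert 0 M" using y by (cases y) auto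
      show ?thesis
      proof (cases "m = 0")
        case True
        with m show ?thesis by (intro bexI[OF _ dilation_in_stab[OF one_in_M]]) simp
      next
        case False
        then have "moebius_map (m / e) 0 0 1 \<circ> g \<in> stab"
          using m e assms(1) by (intro stab_comp dilation_in_stab) (auto simp: divide_in_M)
        then show ?thesis using e m zero_notin_M by (intro bexI) auto
      qed
    qed
    then obtain h where h: "h \<in> stab" "h (Some 0) = y" by blast
    have hG: "h \<in> carrier PGL2" using h by (simp add: setwise_stabilizer_def)
    have inv: "inv_into UNIV h \<circ> h = id" "h \<circ> inv_into UNIV h = id"
      using PGL2_bij[OF hG] by (auto simp: bij_is_inj bij_is_surj surj_iff[symmetric])
    have hy: "inv_into UNIV h y = Some 0" using h PGL2_image_eq_iff[OF hG] by blast
    have "bij_betw ((\<circ>) h) {f \<in> stab. f (Some 0) = Some 0} {f \<in> stab. f (Some 0) = y}"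
      by (rule bij_betw_byWitness[where f' = "(\<circ>) (inv_into UNIV h)"])
        (use h hy in \<open>auto simp: o_assoc inv stab_comp stab_inv\<close>)
    then show ?thesis using card_stab_fixing_0 by (simp add: bij_betw_same_card)
  qed
  have "stab = (\<Union>y\<in>block. {h \<in> stab. h (Some 0) = y})"
    using stab_in_block[of _ "Some 0"] by auto
  then have "card stab = card (\<Union>y\<in>block. {h \<in> stab. h (Some 0) = y})" by simp
  also have "\<dots> = (\<Sum>y\<in>block. card {h \<in> stab. h (Some 0) = y})"
    by (intro card_UN_disjoint) auto
  also have "\<dots> = (k + 1) * k" by (simp add: fibre card_block)
  finally show ?thesis .
qed

lemma card_stab_if_fixes_0:
  assumes "\<And>g. g \<in> stab \<Longrightarrow> g (Some 0) = Some 0"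
  shows "card stab = k"
  using card_stab_fixing_0 assms by (metis (mono_tags, lifting) Collect_cong Collect_mem_eq)

section \<open>Elements of the stabilizer that move 0\<close>

text \<open>The map \<open>(1 - x) / (1 + 2 x)\<close> exchanges 0 with 1 and the two primitive cube
  roots of unity with each other; its determinant is \<open>- 3\<close>.\<close>

lemma stab_moves_0_if_k_eq_3:
  assumes "k = 3"
  shows "\<exists>g\<in>stab. g (Some 0) \<noteq> Some 0"
proof (rule bexI)
  have three: "(3 :: 'a) \<noteq> 0" using k_nonzero assms by simp
  show "moebius_map (- 1) 1 2 1 \<in> stab"
  proof (rule stabI)
    have "(- 1) * 1 - 1 * 2 = - (3 :: 'a)" by simp
    with three show "moebius_map (- 1) 1 2 (1 :: 'a) \<in> carrier PGL2"
      by (intro moebius_map_in_PGL2) simp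
  next
    fix x assume "x \<in> insert 0 M"
    then consider "x = 0" | "x = 1" | "x \<noteq> 1" "x ^ 3 = 1" using M_eq assms by auto
    then show "moebius_map (- 1) 1 2 1 (Some x) \<in> block"
    proof cases
      case 1
      then show ?thesis using one_in_M by simp
    next
      case 2
      then show ?thesis using three by simp
    next
      case 3
      have "(x - 1) * (x ^ 2 + x + 1) = 0"
        using 3 by (simp add: algebra_simps power2_eq_square power3_eq_cube)
      then have "x ^ 2 + x + 1 = 0" using 3 unfolding mult_eq_0_iff by auto
      then have "x ^ 2 - (- x - 1) = 0" by (simp add: algebra_simps)
      then have x2: "x ^ 2 = - x - 1" by (simp only: right_minus_eq)
      \<comment> \<open>The square of the denominator is \<open>- 3\<close>, so the denominator does
        not vanish at a primitive cube root of unity.\<close>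
      have "(2 * x + 1) ^ 2 = 4 * x ^ 2 + 4 * x + 1" by (simp add: power2_eq_square algebra_simps)
      also have "\<dots> = - 3" unfolding x2 by (simp add: algebra_simps)
      finally have nz: "2 * x + 1 \<noteq> 0" using three by auto
      have "x ^ 2 * (2 * x + 1) = 2 * x ^ 3 + x ^ 2"
        by (simp add: power2_eq_square power3_eq_cube algebra_simps)
      also have "\<dots> = 1 - x" using 3 x2 by simp
      finally have "(1 - x) / (2 * x + 1) = x ^ 2" using nz by (simp add: field_simps)
      moreover have "x ^ 2 \<in> M" using 3 assms by (simp add: M_eq power2_eq_square power_mult_distrib)
      ultimately show ?thesis using nz by simp
    qed
  qed
qed simp

text \<open>Here \<open>k + 1\<close> is a power of the characteristic, so raising to it is additive
  and fixes 1; translation by 1 thus preserves its fixed points, which form the block.\<close>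

lemma stab_moves_0_if_dvd:
  assumes "(k + 1) dvd CHAR('a) ^ n"
  shows "\<exists>g\<in>stab. g (Some 0) \<noteq> Some 0"
proof (rule bexI)
  have p: "prime CHAR('a)" by (simp add: finite_imp_CHAR_pos prime_CHAR_semidom)
  obtain i where i: "k + 1 = CHAR('a) ^ i"
    using assms divides_primepow_nat[OF p] by blast
  show "moebius_map 1 1 0 1 \<in> stab"
  proof (rule stabI)
    fix x assume "x \<in> insert 0 M"
    then have "(x + 1) ^ (k + 1) = x + 1"
      using freshmans_dream'[OF p i, of x 1] in_insert_0_M_iff by simp
    then show "moebius_map 1 1 0 1 (Some x) \<in> block" using in_insert_0_M_iff by simp
  qed (intro moebius_map_in_PGL2, simp)
qed simp

section \<open>Polynomial constraints on the stabilizer\<close>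

text \<open>Clearing denominators in \<open>y ^ (k + 1) = y\<close> for the image \<open>y\<close>
  of a point of the block shows that the left side vanishes on the \<open>k + 1\<close> elements of
  \<open>insert 0 M\<close>, as \<open>x ^ (k + 1) - x\<close> does. Both have degree at most
  \<open>k + 1\<close>.\<close>

lemma stab_poly_identity:
  assumes "moebius_map a b c d \<in> stab"
  obtains l where "[:b, a:] ^ (k + 1) - [:b, a:] * [:d, c:] ^ k
      = smult l ([:0, 1:] ^ (k + 1) - [:0, 1:])"
    and "c = 0 \<Longrightarrow> l = a ^ (k + 1)"
proof -
  let ?F = "[:b, a:] ^ (k + 1) - [:b, a:] * [:d, c:] ^ k"
  let ?P = "[:0, 1:] ^ (k + 1) - [:0, 1:] :: 'a poly"
  \<comment> \<open>Since \<open>?P\<close> is monic of degree \<open>k + 1\<close>, the factor can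
    only be this coefficient.\<close>
  define l where "l = poly.coeff ?F (k + 1)"
  have coeff_P: "poly.coeff ([:0, 1:] ^ (k + 1)) (k + 1) = (1 :: 'a)"
    using lead_coeff_power[of "[:0, 1:] :: 'a poly" "k + 1"]
    by (simp add: degree_power_eq del: power_Suc)
  have deg1: "Polynomial.degree ([:x, y:] ^ n) \<le> n" for x y :: 'a and n
    by (rule order.trans[OF degree_power_le]) auto
  have "Polynomial.degree ([:b, a:] * [:d, c:] ^ k) \<le> 1 + k"
    by (rule order.trans[OF degree_mult_le add_mono[OF _ deg1]]) auto
  then have degF: "Polynomial.degree ?F \<le> k + 1" by (intro degree_diff_le deg1) simp
  have degP: "Polynomial.degree ?P \<le> k + 1" by (intro degree_diff_le deg1) simp
  have "?F = smult l ?P"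
  proof (rule poly_eqI_degree_lead_coeff[where A = "insert 0 M" and n = "k + 1"])
    show "poly.coeff ?F (k + 1) = poly.coeff (smult l ?P) (k + 1)"
      using coeff_P k_ge by (simp add: l_def coeff_pCons split: nat.split del: power_Suc)
    show "Polynomial.degree (smult l ?P) \<le> k + 1"
      using degP degree_smult_le order.trans by blast
  next
    fix x assume x: "x \<in> insert 0 M"
    have "moebius_map a b c d (Some x) \<in> block"
      using stab_in_block[OF assms] x Some_in_block_iff by blast
    then have nz: "c * x + d \<noteq> 0" and "(a * x + b) / (c * x + d) \<in> insert 0 M"
      by (auto split: if_splits)
    then have fixd: "((a * x + b) / (c * x + d)) ^ (k + 1) = (a * x + b) / (c * x + d)"
      using in_insert_0_M_iff by blast
    have "(a * x + b) ^ (k + 1) = ((a * x + b) / (c * x + d)) ^ (k + 1) * (c * x + d) ^ (k + 1)"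
      using nz by (simp add: power_divide del: power_Suc)
    also have "\<dots> = (a * x + b) * (c * x + d) ^ k"
      unfolding fixd using nz by simp
    finally have "(a * x + b) ^ (k + 1) = (a * x + b) * (c * x + d) ^ k" .
    then have "(b + x * a) ^ (k + 1) = (b + x * a) * (d + x * c) ^ k"
      by (simp only: add.commute mult.commute)
    moreover have "x ^ (k + 1) = x" using x in_insert_0_M_iff by blast
    ultimately show "poly ?F x = poly (smult l ?P) x" by (simp add: algebra_simps del: power_Suc)
  qed (use card_insert_0_M degF in auto)
  moreover have "l = a ^ (k + 1)" if "c = 0"
  proof -
    \<comment> \<open>With \<open>c = 0\<close> the second product is at most linear and does not
      reach degree \<open>k + 1\<close>.\<close>
    have "Polynomial.degree ([:b, a:] * [:d, c:] ^ k) \<le> 1 + 0"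
      using that by (intro order.trans[OF degree_mult_le add_mono]) (auto simp: poly_const_pow)
    then have "poly.coeff ([:b, a:] * [:d, c:] ^ k) (k + 1) = 0"
      using k_ge by (intro coeff_eq_0) simp
    moreover have "poly.coeff ([:b, a:] ^ (k + 1)) (k + 1) = a ^ (k + 1)"
    proof (cases "a = 0")
      case False
      then show ?thesis using lead_coeff_power[of "[:b, a:]" "k + 1"]
        by (simp add: degree_power_eq del: power_Suc)
    qed (simp add: poly_const_pow)
    ultimately show ?thesis by (simp add: l_def)
  qed
  ultimately show ?thesis using that by blast
qed

text \<open>The point sent to infinity would be a multiple zero of the Hessian covariant
  \<open>(k + 1) f f'' - k f'\<^sup>2\<close> of \<open>f = x\<^bsup>k+1\<^esup> - x\<close>. This covariant is
  \<open>- k ((k\<^sup>2 - 1) x\<^sup>k + 1)\<close>, which has only simple zeros.\<close>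

lemma stab_fixes_infinity:
  assumes g: "moebius_map a b c d \<in> stab" and det: "a * d - b * c \<noteq> 0" and k4: "k \<ge> 4"
  shows "c = 0"
proof (rule ccontr)
  assume c: "c \<noteq> 0"
  obtain m where m: "k = m + 4" using k4 by (metis add.commute le_Suc_ex)
  obtain l where l: "[:b, a:] ^ (k + 1) - [:b, a:] * [:d, c:] ^ k
      = smult l ([:0, 1:] ^ (k + 1) - [:0, 1:])"
    using stab_poly_identity[OF g] by blast
  define u where "u = [:b, a:]"
  define v where "v = [:d, c:]"
  define X where "X = ([:0, 1:] :: 'a poly)"
  \<comment> \<open>The point sent to infinity; \<open>w\<close> is the numerator there, nonzero by
    the determinant.\<close>
  define x where "x = - d / c"
  define w where "w = b + x * a"
  define K :: 'a where "K = of_nat k"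
  \<comment> \<open>\<open>R\<close> equals \<open>- u * v ^ k\<close> with
    \<open>k \<ge> 4\<close>, so at \<open>x\<close> the polynomials
    \<open>l (X ^ (k + 1) - X)\<close> and \<open>u ^ (k + 1)\<close> agree up to the third
    derivative.\<close>
  define R where "R = smult l (X ^ (k + 1) - X) - u ^ (k + 1)"
  have vx: "poly v x = 0" using c by (simp add: v_def x_def)
  have "w * c = - (a * d - b * c)" using c by (simp add: w_def x_def field_simps)
  with det have w: "w \<noteq> 0" by auto
  have "R = v ^ 4 * (- u * v ^ m)"
    using l unfolding R_def X_def u_def v_def m by (simp add: power_add algebra_simps)
  then have d0: "v ^ Suc (Suc (Suc (Suc 0))) dvd R" by (simp add: numeral_eq_Suc)
  note d1 = dvd_pderiv_of_power_Suc_dvd[OF d0]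
  note d2 = dvd_pderiv_of_power_Suc_dvd[OF d1]
  note d3 = dvd_pderiv_of_power_Suc_dvd[OF d2]
  have root: "poly p x = 0" if "v ^ Suc n dvd p" for n p
    using that vx by (auto simp: dvd_def)
  have pX: "pderiv X = 1" "poly X x = x" and pu: "pderiv u = [:a:]" "poly u x = w"
    by (simp_all add: X_def u_def w_def pderiv_pCons)
  note pd = pderiv_diff pderiv_smult pderiv_power_Suc pderiv_mult pX pu
  have R: "R = smult l (X ^ Suc (m + 4) - X) - u ^ Suc (m + 4)" by (simp add: R_def m)
  have K: "K = of_nat m + 4" by (simp add: K_def m)
  have R1: "pderiv R = smult l (smult (K + 1) (X ^ Suc (m + 3)) - 1)
      - smult (K + 1) (smult a (u ^ Suc (m + 3)))"
    unfolding R pd by (simp add: K algebra_simps numeral_eq_Suc)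
  have R2: "pderiv (pderiv R) = smult l (smult ((K + 1) * K) (X ^ Suc (m + 2)))
      - smult ((K + 1) * K * a ^ 2) (u ^ Suc (m + 2))"
    unfolding R1 pd by (simp add: pd K algebra_simps numeral_eq_Suc)
  have R3: "pderiv (pderiv (pderiv R)) = smult l (smult ((K + 1) * K * (K - 1)) (X ^ (m + 2)))
      - smult ((K + 1) * K * (K - 1) * a ^ 3) (u ^ (m + 2))"
    unfolding R2 pd by (simp add: K algebra_simps numeral_eq_Suc)
  define y where "y = x ^ (m + 2)"
  define z where "z = w ^ (m + 2)"
  have E0: "l * (y * x ^ 3 - x) = z * w ^ 3"
    using root[OF d0] unfolding R by (simp add: pX pu y_def z_def power_add numeral_eq_Suc ac_simps)
  have E1: "l * ((K + 1) * (y * x ^ 2) - 1) = (K + 1) * a * (z * w ^ 2)"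
    using root[OF d1] unfolding R1
    by (simp add: pX pu y_def z_def power_add numeral_eq_Suc ac_simps)
  have E2: "l * ((K + 1) * K * (y * x)) = (K + 1) * K * a ^ 2 * (z * w)"
    using root[OF d2] unfolding R2
    by (simp add: pX pu y_def z_def power_add numeral_eq_Suc ac_simps)
  have E3: "l * ((K + 1) * K * (K - 1) * y) = (K + 1) * K * (K - 1) * a ^ 3 * z"
    using root[OF d3] unfolding R3
    by (simp add: pX pu y_def z_def ac_simps)
  have l0: "l \<noteq> 0" using E0 w by (auto simp: z_def)
  \<comment> \<open>By \<open>E0\<close>, \<open>E1\<close> and \<open>E2\<close> the covariant of
    \<open>l (X ^ (k + 1) - X)\<close> at \<open>x\<close> equals that of
    \<open>u ^ (k + 1)\<close>, and it vanishes on \<open>(k + 1)\<close>-th powers of linear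
    polynomials.\<close>
  have "l ^ 2 * ((K + 1) * ((y * x ^ 3 - x) * ((K + 1) * K * (y * x)))
      - K * ((K + 1) * (y * x ^ 2) - 1) ^ 2)
    = (K + 1) * ((l * (y * x ^ 3 - x)) * (l * ((K + 1) * K * (y * x))))
      - K * (l * ((K + 1) * (y * x ^ 2) - 1)) ^ 2"
    by (simp add: algebra_simps power2_eq_square)
  also have "\<dots> = 0" unfolding E0 E1 E2 by (simp add: algebra_simps power2_eq_square power3_eq_cube)
  finally have "(K + 1) * ((y * x ^ 3 - x) * ((K + 1) * K * (y * x)))
      - K * ((K + 1) * (y * x ^ 2) - 1) ^ 2 = 0"
    using l0 by (simp only: mult_eq_0_iff power_eq_0_iff) simp
  then have "K * ((K ^ 2 - 1) * (y * x ^ 2) + 1) = 0"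
    by (simp add: algebra_simps power2_eq_square power3_eq_cube)
  then have H: "(K ^ 2 - 1) * (y * x ^ 2) + 1 = 0" using k_nonzero by (simp add: K_def)
  \<comment> \<open>The same for the derivative of the covariant,
    \<open>(k + 1) f f''' - (k - 1) f' f''\<close>, so \<open>x\<close> is a multiple zero.\<close>
  have "l ^ 2 * ((K + 1) * ((y * x ^ 3 - x) * ((K + 1) * K * (K - 1) * y))
      - (K - 1) * (((K + 1) * (y * x ^ 2) - 1) * ((K + 1) * K * (y * x))))
    = (K + 1) * ((l * (y * x ^ 3 - x)) * (l * ((K + 1) * K * (K - 1) * y)))
      - (K - 1) * ((l * ((K + 1) * (y * x ^ 2) - 1)) * (l * ((K + 1) * K * (y * x))))"
    by (simp add: algebra_simps power2_eq_square)
  also have "\<dots> = 0"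
    unfolding E0 E1 E2 E3 by (simp add: algebra_simps power2_eq_square power3_eq_cube)
  finally have "(K + 1) * ((y * x ^ 3 - x) * ((K + 1) * K * (K - 1) * y))
      - (K - 1) * (((K + 1) * (y * x ^ 2) - 1) * ((K + 1) * K * (y * x))) = 0"
    using l0 by (simp only: mult_eq_0_iff power_eq_0_iff) simp
  then have "K ^ 2 * ((K ^ 2 - 1) * (y * x)) = 0"
    by (simp add: algebra_simps power2_eq_square power3_eq_cube)
  then have "(K ^ 2 - 1) * (y * x) = 0" using k_nonzero by (simp add: K_def)
  \<comment> \<open>Multiplying by \<open>x\<close> kills the first term of \<open>H\<close>,
    leaving \<open>1 = 0\<close>.\<close>
  then have "(K ^ 2 - 1) * (y * x ^ 2) = 0" by (auto simp: power2_eq_square)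
  with H show False by simp
qed

text \<open>\<open>g\<close> is affine. Once \<open>a / d \<in> M\<close> is known, removing this
  dilation leaves translation by \<open>b / d\<close>, and conjugation by dilations yields
  translation by every element of \<open>M\<close>.\<close>

lemma dvd_card_if_stab_moves_0:
  assumes g: "g \<in> stab" "g (Some 0) \<noteq> Some 0" and k4: "k \<ge> 4"
  shows "(k + 1) dvd CARD('a)"
proof -
  obtain a b c d where gm: "g = moebius_map a b c d" "a * d - b * c \<noteq> 0"
    using g(1) by (auto simp: setwise_stabilizer_def elim: PGL2_cases)
  have c: "c = 0" using stab_fixes_infinity g(1) gm k4 by blast
  have nz: "a \<noteq> 0" "d \<noteq> 0" "b \<noteq> 0" using gm c g(2) by auto
  define \<phi> where "\<phi> x = (a * x + b) / d" for x
  have \<phi>: "\<phi> x \<in> insert 0 M" if "x \<in> insert 0 M" for x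
  proof -
    have "g (Some x) \<in> block" using stab_in_block[OF g(1)] that Some_in_block_iff by blast
    then show ?thesis using gm c nz by (simp add: \<phi>_def)
  qed
  have "inj \<phi>" using nz by (auto simp: inj_def \<phi>_def)
  then have inj: "inj_on \<phi> (insert 0 M)" by (rule inj_on_subset) simp
  have "\<phi> ` insert 0 M = insert 0 M" by (intro endo_inj_surj inj image_subsetI \<phi>) auto
  with inj have "bij_betw \<phi> (insert 0 M) (insert 0 M)" by (simp add: bij_betw_def)
  \<comment> \<open>\<open>insert 0 M\<close> has sum 0 and \<open>\<phi>\<close> permutes it, so
    \<open>(k + 1) b / d = 0\<close> with \<open>b \<noteq> 0\<close>.\<close>
  from sum.reindex_bij_betw[OF this, of "\<lambda>x. x"]
  have "(\<Sum>x\<in>insert 0 M. \<phi> x) = \<Sum>(insert 0 M)" .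
  moreover have sum0: "\<Sum>(insert 0 M) = 0" using zero_notin_M sum_M by simp
  moreover have "(\<Sum>x\<in>insert 0 M. \<phi> x) = (\<Sum>x\<in>insert 0 M. a / d * x + b / d)"
    by (intro sum.cong) (auto simp: \<phi>_def add_divide_distrib)
  moreover have "\<dots> = a / d * \<Sum>(insert 0 M) + of_nat (k + 1) * (b / d)"
    unfolding sum.distrib sum_distrib_left[symmetric] sum_constant card_insert_0_M ..
  ultimately have K: "of_nat (k + 1) = (0 :: 'a)" using nz by simp
  obtain l where l: "[:b, a:] ^ (k + 1) - [:b, a:] * [:d, c:] ^ k
      = smult l ([:0, 1:] ^ (k + 1) - [:0, 1:])" "l = a ^ (k + 1)"
    using stab_poly_identity g(1) gm c by metis
  \<comment> \<open>As \<open>k + 1\<close> is 0 in the field, \<open>(k + 1)\<close>-th powers have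
    derivative 0, and differentiating the identity leaves only \<open>a * d ^ k = l\<close>.\<close>
  have "pderiv ([:b, a:] ^ (k + 1)) = 0" "pderiv ([:0, 1:] ^ (k + 1)) = (0 :: 'a poly)"
    unfolding pderiv_power K by simp_all
  then have "- [:a * d ^ k:] = - [:l:]"
    using arg_cong[OF l(1), of pderiv] c
    by (simp add: pderiv_diff pderiv_smult pderiv_mult pderiv_pCons poly_const_pow mult.commute
        del: power_Suc)
  then have "a ^ k = d ^ k" using l(2) nz by simp
  then have ad: "d / a \<in> M" using nz by (simp add: M_eq power_divide)
  have mult: "x * y \<in> insert 0 M" if "x \<in> M" "y \<in> insert 0 M" for x y
    using that mult_in_M by auto
  define e where "e = b / d"
  have e: "e \<in> M" using \<phi>[of 0] nz by (auto simp: \<phi>_def e_def)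
  \<comment> \<open>\<open>y + e\<close> is the value of \<open>\<phi>\<close> at
    \<open>d / a * y\<close>.\<close>
  have add_e: "y + e \<in> insert 0 M" if "y \<in> insert 0 M" for y
    using \<phi>[OF mult[OF ad that]] nz by (simp add: \<phi>_def e_def add_divide_distrib)
  have "x + y \<in> insert 0 M" if x: "x \<in> insert 0 M" and y: "y \<in> insert 0 M" for x y
  proof (cases "x = 0")
    case False
    then have xM: "x \<in> M" using x by simp
    have e0: "e \<noteq> 0" using e zero_notin_M by auto
    have "x / e * (e / x * y + e) \<in> insert 0 M"
      using mult[OF divide_in_M[OF xM e] add_e[OF mult[OF divide_in_M[OF e xM] y]]] .
    moreover have "x / e * (e / x * y + e) = x + y" using False e0 by (simp add: field_simps)
    ultimately show ?thesis by (simp only:)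
  qed (use y in simp)
  from card_add_closed_dvd_card_UNIV[OF _ this] show ?thesis
    using card_insert_0_M by simp
qed

end

section \<open>The value of \<lambda> in the three cases\<close>

theorem theorem4:
  fixes \<theta> :: "'a::{field,finite}"
    and p n q k r :: nat
    and B :: "'a option set"
  assumes "prime p"
    and "q = p ^ n"
    and "CARD('a) = q"
    and "primitive_element \<theta>"
    and "k \<ge> 3"
    and "r \<ge> 1"
    and "q - 1 = k * r"
    and "B = Some ` (mult_span (\<theta> ^ r) \<union> {0})"
  shows "simple_three_design (UNIV :: 'a option set)
    (mset_set (orbit PGL2 (subset_action (k + 1)) B))
    (q + 1) (k + 1)
    (if k = 3 then 2
     else if \<not> (k + 1) dvd q then (k + 1) * (k - 1)
     else k - 1)"
proof -
  let ?l = "if k = 3 then 2 else if \<not> (k + 1) dvd q then (k + 1) * (k - 1) else k - 1"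
  let ?O = "orbit PGL2 (subset_action (k + 1)) B"
  have span: "mult_span (\<theta> ^ r) = {x. x ^ k = 1}" "card {x :: 'a. x ^ k = 1} = k"
    using assms by (intro mult_span_power_primitive[of \<theta> k r]; simp)+
  have char_dvd: "CHAR('a) dvd q" using CHAR_dvd_CARD[where 'a = 'a] assms(3) by simp
  have "prime CHAR('a)" by (simp add: finite_imp_CHAR_pos prime_CHAR_semidom)
  then have char: "CHAR('a) = p"
    using char_dvd assms(1,2) prime_dvd_power primes_dvd_imp_eq by blast
  have "q > 0" using assms(3) by auto
  \<comment> \<open>In the field \<open>k r = q - 1 = - 1\<close>, so \<open>k\<close> cannot be 0
    there.\<close>
  then have "of_nat (k * r) + 1 = (of_nat q :: 'a)"
    using assms(7) by (metis Suc_pred' Suc_eq_plus1 of_nat_Suc add.commute)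
  also have "\<dots> = 0" using char_dvd by (simp add: of_nat_eq_0_iff_char_dvd)
  finally have "of_nat k \<noteq> (0 :: 'a)" by auto
  then interpret unity_block k "{x :: 'a. x ^ k = 1}"
    using assms span by unfold_locales auto
  have B: "B = block" unfolding assms(8) span block_def by simp
  \<comment> \<open>On sets of size \<open>k + 1\<close>, such as the block, the restricted action
    is the ordinary image.\<close>
  have O: "?O = (\<lambda>g. g ` block) ` carrier PGL2"
    unfolding orbit_def subset_action_def B using card_block by auto
  have "card {b \<in> ?O. T \<subseteq> b} = ?l" if "card T = 3" for T
  proof -
    let ?n = "card {b \<in> ?O. T \<subseteq> b}"
    have count: "?n * card stab = (k + 1) * k * (k - 1)"
      using card_blocks_times_card_stabilizer[OF that, of block] unfolding O card_block
      by (simp add: numeral_eq_Suc)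
    show ?thesis
    proof (cases "\<exists>g\<in>stab. g (Some 0) \<noteq> Some 0")
      case True
      then have "card stab = (k + 1) * k" using card_stab_if_moves_0 by blast
      with count have "?n * ((k + 1) * k) = (k - 1) * ((k + 1) * k)" by (simp only: ac_simps)
      \<comment> \<open>This value is 2 for \<open>k = 3\<close>, so the first and third cases are
        settled together.\<close>
      then have "?n = k - 1" using \<open>k \<ge> 3\<close> by simp
      moreover have "(k + 1) dvd q" if "k \<noteq> 3"
        using True dvd_card_if_stab_moves_0 that \<open>k \<ge> 3\<close> assms(3) by force
      ultimately show ?thesis by auto
    next
      case False
      then have "card stab = k" using card_stab_if_fixes_0 by blast
      with count have "?n * k = (k + 1) * (k - 1) * k" by (simp only: ac_simps)
      then have "?n = (k + 1) * (k - 1)" using \<open>k \<ge> 3\<close> by simp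
      \<comment> \<open>Either of the other two cases would supply an element of the stabilizer
        moving 0.\<close>
      moreover have "k \<noteq> 3" using False stab_moves_0_if_k_eq_3 by blast
      moreover have "\<not> (k + 1) dvd q"
        using False stab_moves_0_if_dvd[of n] assms(2) char by auto
      ultimately show ?thesis by simp
    qed
  qed
  moreover have "finite ?O" by simp
  moreover have "card b = k + 1" if "b \<in> ?O" for b
    using that unfolding O by (auto simp: PGL2_card_image card_block)
  moreover have "CARD('a option) = q + 1" using assms(3) by simp
  ultimately show ?thesis
    unfolding simple_three_design_def three_design_def
    by (auto simp: count_mset_set')
qed

end
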